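(* Let $\Pi$ be a plane in $\mathbb{R}^3$, $\triangle A_0B_0C_0$ an equilateral triangle in $\Pi$, and $\Gamma_0\subset\Pi$ the circumcircle of $\triangle A_0B_0C_0$. Let $\triangle ABC$ be any non-equilateral triangle. Let $P$ (respectively $P'$) be the unique point of $\Pi$ inside (respectively outside) $\Gamma_0$ such that $\triangle(|P-A_0|,|P-B_0|,|P-C_0|)\sim\triangle ABC$ (respectively $\triangle(|P'-A_0|,|P'-B_0|,|P'-C_0|)\sim\triangle ABC$). Then the set $$S=\{X\in\mathbb{R}^3:\ \triangle(|X-A_0|,|X-B_0|,|X-C_0|)\sim\triangle ABC\}$$ is a circle with diameter $PP'$ that intersects $\Pi$ orthogonally. Moreover, denoting this circle by $\Gamma_{ABC}$ and the plane containing it by $\Pi^\perp_{ABC}$, the circle $\Gamma_{ABC}$ is a circle of Apollonius in $\Pi^\perp_{ABC}$ whose foci are the two points of $\Gamma_0\cap\Pi^\perp_{ABC}$.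
   Context: Triangles are non-degenerate with ordered vertices. For $a,b,c>0$ satisfying the three strict triangle inequalities, $\triangle(a,b,c)$ denotes any triangle $\triangle ABC$ (in the plane, vertices labeled anti-clockwise) with $|B-C|=a$, $|C-A|=b$, $|A-B|=c$. Here $\triangle ABC$ is a planar triangle with vertices labeled anti-clockwise, and $\sim$ means similarity by a composition of homothety, rotation and translation respecting the order of vertices; the assertion $\triangle(a,b,c)\sim\triangle ABC$ includes that $a,b,c$ are side lengths of a (non-degenerate) triangle. Existence and uniqueness of $P$ and $P'$ in $\Pi$ hold for every non-equilateral $\triangle ABC$. A circle of Apollonius with foci $W\neq W'$ in a plane is the set of points $X$ of the plane for which the ratio $|X-W|:|X-W'|$ has a given constant value. *)

theory Defs
  imports "HOL-Analysis.Analysis"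
begin

definition equilateral :: "'a::metric_space \<Rightarrow> 'a \<Rightarrow> 'a \<Rightarrow> bool" where
  "equilateral A B C \<longleftrightarrow> A \<noteq> B \<and> dist A B = dist B C \<and> dist B C = dist C A"

text \<open>Twice the signed area of the triangle is positive; in particular the triangle is
  non-degenerate.\<close>
definition anticlockwise :: "complex \<Rightarrow> complex \<Rightarrow> complex \<Rightarrow> bool" where
  "anticlockwise A B C \<longleftrightarrow> Im (cnj (B - A) * (C - A)) > 0"

text \<open>The order of the vertices matters. The map \<open>z \<mapsto> k * cis \<theta> * z + t\<close> is
  a rotation followed by a homothety and a translation.\<close>
definition similar_triangles ::
  "complex \<Rightarrow> complex \<Rightarrow> complex \<Rightarrow> complex \<Rightarrow> complex \<Rightarrow> complex \<Rightarrow> bool" where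
  "similar_triangles A B C A' B' C' \<longleftrightarrow>
     (\<exists>k>0. \<exists>\<theta> t. (let f = (\<lambda>z. of_real k * cis \<theta> * z + t)
                   in f A = A' \<and> f B = B' \<and> f C = C'))"

definition triangle_with_sides ::
  "real \<Rightarrow> real \<Rightarrow> real \<Rightarrow> complex \<Rightarrow> complex \<Rightarrow> complex \<Rightarrow> bool" where
  "triangle_with_sides a b c A B C \<longleftrightarrow>
     anticlockwise A B C \<and> dist B C = a \<and> dist C A = b \<and> dist A B = c"

text \<open>A triangle with sides \<open>a\<close>, \<open>b\<close>, \<open>c\<close> is unique up to rotation and
  translation, so asking for one such triangle similar to \<open>A B C\<close> is the same as asking that
  such triangles exist and all of them are similar to it. The condition fails if
  \<open>a\<close>, \<open>b\<close>, \<open>c\<close> are not the sides of a non-degenerate triangle.\<close>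
definition sides_similar ::
  "real \<Rightarrow> real \<Rightarrow> real \<Rightarrow> complex \<Rightarrow> complex \<Rightarrow> complex \<Rightarrow> bool" where
  "sides_similar a b c A B C \<longleftrightarrow>
     (\<exists>A' B' C'. triangle_with_sides a b c A' B' C' \<and> similar_triangles A' B' C' A B C)"

definition similarity_locus ::
  "real^3 \<Rightarrow> real^3 \<Rightarrow> real^3 \<Rightarrow> complex \<Rightarrow> complex \<Rightarrow> complex \<Rightarrow> (real^3) set" where
  "similarity_locus A0 B0 C0 A B C =
     {X. sides_similar (dist X A0) (dist X B0) (dist X C0) A B C}"

definition is_plane :: "(real^3) set \<Rightarrow> bool" where
  "is_plane E \<longleftrightarrow> affine E \<and> aff_dim E = 2"

text \<open>\<open>K\<close> is the (proper) circle in the plane \<open>E\<close> with centre \<open>M\<close> and radius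
  \<open>r\<close>.\<close>
definition is_circle :: "(real^3) set \<Rightarrow> (real^3) set \<Rightarrow> real^3 \<Rightarrow> real \<Rightarrow> bool" where
  "is_circle K E M r \<longleftrightarrow> is_plane E \<and> M \<in> E \<and> r > 0 \<and> K = E \<inter> sphere M r"

text \<open>The tangent line at the point \<open>X\<close> of a circle in the plane \<open>E\<close> with centre
  \<open>M\<close>.\<close>
definition tangent_line :: "(real^3) set \<Rightarrow> real^3 \<Rightarrow> real^3 \<Rightarrow> (real^3) set" where
  "tangent_line E M X = {Y \<in> E. orthogonal (Y - X) (X - M)}"

definition perpendicular :: "(real^3) set \<Rightarrow> (real^3) set \<Rightarrow> bool" where
  "perpendicular L F \<longleftrightarrow> (\<forall>Y\<in>L. \<forall>Z\<in>L. \<forall>U\<in>F. \<forall>V\<in>F. orthogonal (Y - Z) (U - V))"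

definition circle_meets_orthogonally ::
  "(real^3) set \<Rightarrow> (real^3) set \<Rightarrow> real^3 \<Rightarrow> (real^3) set \<Rightarrow> bool" where
  "circle_meets_orthogonally K E M F \<longleftrightarrow>
     K \<inter> F \<noteq> {} \<and> (\<forall>X \<in> K \<inter> F. perpendicular (tangent_line E M X) F)"

definition is_diameter :: "real^3 \<Rightarrow> real^3 \<Rightarrow> (real^3) set \<Rightarrow> real^3 \<Rightarrow> bool" where
  "is_diameter P Q K M \<longleftrightarrow> P \<in> K \<and> Q \<in> K \<and> M = midpoint P Q"

text \<open>As \<open>x / 0 = 0\<close>, the point \<open>W'\<close> does not satisfy the equation for \<open>k > 0\<close>.\<close>
definition is_Apollonius_circle ::
  "(real^3) set \<Rightarrow> (real^3) set \<Rightarrow> real^3 \<Rightarrow> real^3 \<Rightarrow> bool" where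
  "is_Apollonius_circle K E W W' \<longleftrightarrow>
     W \<in> E \<and> W' \<in> E \<and> W \<noteq> W' \<and>
     (\<exists>k>0. K = {X \<in> E. dist X W / dist X W' = k})"

end

theory Submission
  imports Defs
begin

text \<open>Write \<open>a\<close>, \<open>b\<close>, \<open>c\<close> for the sides of \<open>A B C\<close>, and \<open>Q = a\<^sup>2 + b\<^sup>2 + c\<^sup>2\<close>.
  Put the origin at the circumcentre \<open>M0\<close>, which is also the centroid of \<open>A0 B0 C0\<close>. Then \<open>X\<close>
  lies on the locus iff \<open>|x|\<^sup>2 + R\<^sup>2 - 2 x \<bullet> A0 = k\<^sup>2 a\<^sup>2\<close> and cyclically, for some \<open>k > 0\<close>.
  Summing the three equations gives \<open>3 (|x|\<^sup>2 + R\<^sup>2) = k\<^sup>2 Q\<close>, so the scale is determined, and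
  what remains says that the orthogonal projection of \<open>x\<close> to the plane is
  \<open>(|x|\<^sup>2 + R\<^sup>2) v\<close> with \<open>v = - (a\<^sup>2 A0 + b\<^sup>2 B0 + c\<^sup>2 C0) / (R\<^sup>2 Q)\<close>. Here \<open>v \<noteq> 0\<close> because
  \<open>A B C\<close> is not equilateral, and \<open>2 R |v| < 1\<close> is Heron's inequality. In the plane spanned by
  \<open>v\<close> and the normal, with \<open>t\<close> the coordinate along \<open>v\<close>, this is the circle
  \<open>|x|\<^sup>2 - t / |v| + R\<^sup>2 = 0\<close>, with respect to which the two points \<open>t = \<plusminus> R\<close> of the
  circumcircle are inverse to each other.\<close>

section \<open>Similarity and Heron's inequality for plane triangles\<close>

text \<open>A similarity multiplies all distances by its factor, and a homothetic copy of
  \<open>A B C\<close> realises every triple proportional to its sides. The locus is thereby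
  described by proportional distances alone.\<close>

lemma sides_similar_iff:
  assumes "anticlockwise A B C"
  shows "sides_similar p q r A B C \<longleftrightarrow>
    (\<exists>k>0. p = k * dist B C \<and> q = k * dist C A \<and> r = k * dist A B)"
proof
  assume "sides_similar p q r A B C"
  then obtain A' B' C' k \<theta> t where
    sides: "dist B' C' = p" "dist C' A' = q" "dist A' B' = r" and k: "k > 0" and
    im: "A = of_real k * cis \<theta> * A' + t" "B = of_real k * cis \<theta> * B' + t"
      "C = of_real k * cis \<theta> * C' + t"
    unfolding sides_similar_def triangle_with_sides_def similar_triangles_def Let_def by blast
  have d: "dist (of_real k * cis \<theta> * z + t) (of_real k * cis \<theta> * w + t) = k * dist z w" for z w
  proof -
    have "of_real k * cis \<theta> * z + t - (of_real k * cis \<theta> * w + t) = of_real k * cis \<theta> * (z - w)"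
      by (simp add: algebra_simps)
    then show ?thesis using k by (simp add: dist_norm norm_mult)
  qed
  show "\<exists>k>0. p = k * dist B C \<and> q = k * dist C A \<and> r = k * dist A B"
    \<comment> \<open>The similarity maps \<open>A' B' C'\<close> to \<open>A B C\<close>, so its
      factor enters inverted.\<close>
    using k sides unfolding im d by (intro exI[of _ "1 / k"]) auto
next
  assume "\<exists>k>0. p = k * dist B C \<and> q = k * dist C A \<and> r = k * dist A B"
  then obtain k where k: "k > 0" "p = k * dist B C" "q = k * dist C A" "r = k * dist A B" by blast
  let ?f = "\<lambda>z. of_real k * z"
  have d: "dist (?f z) (?f w) = k * dist z w" for z w :: complex
    using k(1) by (simp add: dist_norm norm_mult flip: right_diff_distrib)
  \<comment> \<open>Orientation survives the scaling: twice the signed area is multiplied by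
    \<open>k\<^sup>2\<close>.\<close>
  have "cnj (?f B - ?f A) * (?f C - ?f A) = of_real (k\<^sup>2) * (cnj (B - A) * (C - A))"
    by (simp add: algebra_simps power2_eq_square)
  then have "Im (cnj (?f B - ?f A) * (?f C - ?f A)) = k\<^sup>2 * Im (cnj (B - A) * (C - A))"
    by (simp only: times_complex.sel Re_complex_of_real Im_complex_of_real)
  then have "anticlockwise (?f A) (?f B) (?f C)"
    using assms k(1) by (simp only: anticlockwise_def zero_less_mult_iff zero_less_power simp_thms)
  then have "triangle_with_sides p q r (?f A) (?f B) (?f C)"
    unfolding triangle_with_sides_def d k by simp
  moreover have "similar_triangles (?f A) (?f B) (?f C) A B C"
    unfolding similar_triangles_def Let_def using k(1)
    by (intro exI[of _ "1 / k"] conjI exI[of _ 0]) auto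
  ultimately show "sides_similar p q r A B C" unfolding sides_similar_def by blast
qed

text \<open>Heron's formula: as \<open>a\<close>, \<open>b\<close>, \<open>c\<close> are squared
  sides, right side minus left side is sixteen times the squared area, and the imaginary part is
  twice the signed area.\<close>

lemma heron_pos:
  assumes "anticlockwise A B C"
  defines "a \<equiv> (dist B C)\<^sup>2" and "b \<equiv> (dist C A)\<^sup>2" and "c \<equiv> (dist A B)\<^sup>2"
  shows "a\<^sup>2 + b\<^sup>2 + c\<^sup>2 < 2 * (a * b + b * c + c * a)"
proof -
  have "2 * (a * b + b * c + c * a) - (a\<^sup>2 + b\<^sup>2 + c\<^sup>2) = 4 * (Im (cnj (B - A) * (C - A)))\<^sup>2"
    unfolding a_def b_def c_def dist_norm cmod_power2 by (simp; algebra)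
  moreover have "(Im (cnj (B - A) * (C - A)))\<^sup>2 > 0"
    using assms(1) unfolding anticlockwise_def by simp
  ultimately show ?thesis by linarith
qed

lemma anticlockwise_distinct:
  assumes "anticlockwise A B C"
  shows "A \<noteq> B" "B \<noteq> C" "C \<noteq> A"
  using assms by (auto simp: anticlockwise_def algebra_simps)

section \<open>Orthonormal frames and planes in space\<close>

text \<open>Three orthonormal vectors form a basis of the space, so Parseval's identity holds. It
  reduces geometric claims to polynomial identities in coordinates.\<close>

lemma orthonormal_inner:
  fixes e f n x y :: "real^3"
  assumes "e \<bullet> e = 1" "f \<bullet> f = 1" "n \<bullet> n = 1" and o: "f \<bullet> e = 0" "f \<bullet> n = 0" "e \<bullet> n = 0"
  shows "x \<bullet> y = (x \<bullet> f) * (y \<bullet> f) + (x \<bullet> e) * (y \<bullet> e) + (x \<bullet> n) * (y \<bullet> n)"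
proof -
  have ne: "f \<noteq> e" "f \<noteq> n" "e \<noteq> n" using assms by auto
  have po: "pairwise orthogonal {f, e, n}"
    using o by (auto simp: pairwise_insert orthogonal_def inner_commute)
  have "independent {f, e, n}"
    using po by (rule pairwise_orthogonal_independent) (use assms in auto)
  then have "span {f, e, n} = UNIV"
    using ne by (intro dim_eq_full[THEN iffD1]) (simp add: dim_eq_card_independent)
  then have "(\<Sum>b\<in>{f, e, n}. (x \<bullet> b) *\<^sub>R b) = x"
    using po assms(1-3) by (intro orthonormal_basis_expand) (auto simp: norm_eq_1)
  then have "x = (x \<bullet> f) *\<^sub>R f + (x \<bullet> e) *\<^sub>R e + (x \<bullet> n) *\<^sub>R n"
    using ne by (simp add: add.assoc)
  then have "x \<bullet> y = ((x \<bullet> f) *\<^sub>R f + (x \<bullet> e) *\<^sub>R e + (x \<bullet> n) *\<^sub>R n) \<bullet> y" by metis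
  then show ?thesis by (simp only: inner_add_left inner_scaleR_left inner_commute[of y])
qed

lemma orthonormal_completion:
  fixes f n :: "real^3"
  assumes "f \<bullet> f = 1" "n \<bullet> n = 1" "f \<bullet> n = 0"
  obtains e where "e \<bullet> e = 1" "f \<bullet> e = 0" "e \<bullet> n = 0"
proof -
  have "dim {f, n} < DIM(real^3)"
    using dim_le_card'[of "{f, n}"] by (simp add: card_insert_if split: if_splits)
  then obtain z where z: "z \<noteq> 0" "\<And>y. y \<in> span {f, n} \<Longrightarrow> orthogonal z y"
    using orthogonal_to_subspace_exists by metis
  then have "f \<bullet> z = 0" "z \<bullet> n = 0"
    by (auto simp: orthogonal_def inner_commute span_base)
  then show thesis
    using z(1) by (intro that[of "z /\<^sub>R norm z"]) (auto simp: dot_square_norm power2_eq_square)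
qed

text \<open>A two-dimensional affine set in space is a hyperplane; its normalised normal serves as
  the vector \<open>n\<close> of the frames below.\<close>

lemma is_plane_iff:
  "is_plane E \<longleftrightarrow> (\<exists>n b. n \<bullet> n = 1 \<and> E = {X. n \<bullet> X = b})"
proof
  assume "is_plane E"
  then have "affine hull E = E" "aff_dim E = DIM(real^3) - 1"
    by (auto simp: is_plane_def hull_same)
  then obtain n b where n: "n \<noteq> 0" "E = {X. n \<bullet> X = b}"
    using aff_dim_eq_hyperplane by metis
  have "E = {X. (n /\<^sub>R norm n) \<bullet> X = b / norm n}"
    using n by (auto simp: field_simps)
  moreover have "(n /\<^sub>R norm n) \<bullet> (n /\<^sub>R norm n) = 1"
    using n by (auto simp: dot_square_norm power2_eq_square)
  ultimately show "\<exists>n b. n \<bullet> n = 1 \<and> E = {X. n \<bullet> X = b}" by blast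
next
  assume "\<exists>n b. n \<bullet> n = 1 \<and> E = {X. n \<bullet> X = b}"
  then obtain n b where n: "n \<bullet> n = 1" "E = {X. n \<bullet> X = b}" by blast
  then have "n \<noteq> 0" by auto
  then show "is_plane E"
    unfolding is_plane_def n using affine_hyperplane by (simp add: aff_dim_hyperplane)
qed

section \<open>The equilateral triangle and the equation of the locus\<close>

text \<open>Three vectors in a plane have vanishing Gram determinant, which factors as
  \<open>(\<rho> - g)\<^sup>2 (\<rho> + 2 g)\<close>.\<close>
lemma equilateral_inner:
  fixes u v w n :: "real^3"
  assumes "n \<bullet> n = 1" "u \<bullet> n = 0" "v \<bullet> n = 0" "w \<bullet> n = 0"
    and r: "u \<bullet> u = \<rho>" "v \<bullet> v = \<rho>" "w \<bullet> w = \<rho>"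
    and eq: "dist u v = dist v w" "dist v w = dist w u" and "u \<noteq> v"
  shows "u \<bullet> v = - \<rho> / 2" "v \<bullet> w = - \<rho> / 2" "w \<bullet> u = - \<rho> / 2"
proof -
  have sq: "(dist x y)\<^sup>2 = x \<bullet> x + y \<bullet> y - 2 * (x \<bullet> y)" for x y :: "real^3"
    by (simp add: dist_norm power2_norm_eq_inner inner_diff inner_commute)
  define g where "g = u \<bullet> v"
  have g: "u \<bullet> v = g" "v \<bullet> w = g" "w \<bullet> u = g"
    using sq[of u v] sq[of v w] sq[of w u] r eq by (auto simp: g_def)
  have "\<rho> \<noteq> g"
    using sq[of u v] r g \<open>u \<noteq> v\<close> by auto
  obtain f where f: "f \<bullet> f = 1" "f \<bullet> n = 0"
  proof -
    obtain z where "z \<noteq> 0" "orthogonal n z"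
      using orthogonal_to_vector_exists[of n] by auto
    then show thesis
      by (intro that[of "z /\<^sub>R norm z"])
        (auto simp: dot_square_norm power2_eq_square orthogonal_def inner_commute)
  qed
  then obtain e where e: "e \<bullet> e = 1" "f \<bullet> e = 0" "e \<bullet> n = 0"
    using orthonormal_completion assms(1) by metis
  have ip: "x \<bullet> y = (x \<bullet> f) * (y \<bullet> f) + (x \<bullet> e) * (y \<bullet> e)"
    if "y \<bullet> n = 0" for x y
    using orthonormal_inner[of e f n x y] e f assms(1) that by simp
  \<comment> \<open>Powers are written out on the right so that each factor can be replaced by one
    inner product in the next step.\<close>
  have "(\<rho> - g)\<^sup>2 * (\<rho> + 2 * g)
      = \<rho> * \<rho> * \<rho> + 2 * (g * g * g) - \<rho> * (g * g) - \<rho> * (g * g) - \<rho> * (g * g)"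
    by algebra
  also have "\<dots> = (u \<bullet> u) * (v \<bullet> v) * (w \<bullet> w) + 2 * ((u \<bullet> v) * (v \<bullet> w) * (w \<bullet> u))
      - (u \<bullet> u) * ((v \<bullet> w) * (v \<bullet> w)) - (v \<bullet> v) * ((w \<bullet> u) * (w \<bullet> u))
      - (w \<bullet> w) * ((u \<bullet> v) * (u \<bullet> v))"
    by (simp only: r g)
  \<comment> \<open>Within the plane each vector has only two coordinates, which makes the
    determinant vanish identically.\<close>
  also have "\<dots> = 0"
    unfolding ip[OF assms(2)] ip[OF assms(3)] ip[OF assms(4)] by algebra
  finally have "\<rho> + 2 * g = 0" using \<open>\<rho> \<noteq> g\<close> by simp
  then show "u \<bullet> v = - \<rho> / 2" "v \<bullet> w = - \<rho> / 2" "w \<bullet> u = - \<rho> / 2"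
    using g by auto
qed

text \<open>The locus in terms of the vectors \<open>u\<close>, \<open>v\<close>, \<open>w\<close> from the circumcentre to the
  vertices.\<close>
lemma proportional_distances_iff:
  fixes u v w x :: "real^3" and a b c R :: real
  assumes R: "R > 0" and pos: "a > 0" "b > 0" "c > 0"
    and r: "u \<bullet> u = R\<^sup>2" "v \<bullet> v = R\<^sup>2" "w \<bullet> w = R\<^sup>2"
    and g: "u \<bullet> v = - R\<^sup>2 / 2" "v \<bullet> w = - R\<^sup>2 / 2" "w \<bullet> u = - R\<^sup>2 / 2"
  defines "m \<equiv> (- 1 / (R\<^sup>2 * (a\<^sup>2 + b\<^sup>2 + c\<^sup>2))) *\<^sub>R (a\<^sup>2 *\<^sub>R u + b\<^sup>2 *\<^sub>R v + c\<^sup>2 *\<^sub>R w)"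
  shows "(\<exists>k>0. dist x u = k * a \<and> dist x v = k * b \<and> dist x w = k * c) \<longleftrightarrow>
    (let y = x - (x \<bullet> x + R\<^sup>2) *\<^sub>R m in y \<bullet> u = 0 \<and> y \<bullet> v = 0)"
proof -
  define Q where "Q = a\<^sup>2 + b\<^sup>2 + c\<^sup>2"
  define s where "s = x \<bullet> x + R\<^sup>2"
  have Q: "Q > 0" using pos by (simp add: Q_def add_pos_pos)
  have s: "s > 0" using R by (simp add: s_def add_nonneg_pos)
  have g': "v \<bullet> u = - R\<^sup>2 / 2" "w \<bullet> v = - R\<^sup>2 / 2" "u \<bullet> w = - R\<^sup>2 / 2"
    using g by (simp_all add: inner_commute)
  \<comment> \<open>The vertex of weight \<open>p\<close> contributes \<open>R\<^sup>2\<close>, the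
    other two \<open>- R\<^sup>2 / 2\<close> each, and their weights sum to
    \<open>Q - p\<close>.\<close>
  have coeff: "(- 1 / (R\<^sup>2 * Q)) * (p * R\<^sup>2 + q * (- R\<^sup>2 / 2) + t * (- R\<^sup>2 / 2)) = (1 - 3 * p / Q) / 2"
    if "p + q + t = Q" for p q t
  proof -
    have "p * R\<^sup>2 + q * (- R\<^sup>2 / 2) + t * (- R\<^sup>2 / 2) = R\<^sup>2 * ((3 * p - Q) / 2)"
      unfolding that[symmetric] by (simp add: field_simps)
    then show ?thesis by (simp only:) (use R Q in \<open>simp add: field_simps\<close>)
  qed
  have m: "m \<bullet> u = (1 - 3 * a\<^sup>2 / Q) / 2" "m \<bullet> v = (1 - 3 * b\<^sup>2 / Q) / 2"
      "m \<bullet> w = (1 - 3 * c\<^sup>2 / Q) / 2"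
    using coeff[of "a\<^sup>2" "b\<^sup>2" "c\<^sup>2"] coeff[of "b\<^sup>2" "a\<^sup>2" "c\<^sup>2"] coeff[of "c\<^sup>2" "a\<^sup>2" "b\<^sup>2"]
    unfolding m_def by (simp_all only: Q_def inner_scaleR_left inner_add_left r g g' ac_simps)
  \<comment> \<open>The circumcentre is the centroid: the squared norm is
    \<open>3 * R\<^sup>2 - 3 * R\<^sup>2\<close>.\<close>
  have zero: "u + v + w = 0"
  proof -
    have "(u + v + w) \<bullet> (u + v + w) = 0"
      by (simp add: inner_add_left inner_add_right r g g')
    then show ?thesis by simp
  qed
  have sum: "x \<bullet> u + x \<bullet> v + x \<bullet> w = 0"
    using zero by (metis inner_add_right inner_zero_right)
  have sq: "(dist x z)\<^sup>2 = s - 2 * (x \<bullet> z)" if "z \<bullet> z = R\<^sup>2" for z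
    using that by (simp add: s_def dist_norm power2_norm_eq_inner inner_diff inner_commute)
  \<comment> \<open>For a vertex vector \<open>z\<close> this is the distance equation with
    \<open>k\<^sup>2 = 3 * s / Q\<close>, the scale forced by summing the three equations.\<close>
  have lin: "(x - s *\<^sub>R m) \<bullet> z = 0 \<longleftrightarrow> s - 2 * (x \<bullet> z) = 3 * s / Q * d\<^sup>2"
    if "m \<bullet> z = (1 - 3 * d\<^sup>2 / Q) / 2" for z d
  proof -
    have "(x - s *\<^sub>R m) \<bullet> z = (3 * s / Q * d\<^sup>2 - (s - 2 * (x \<bullet> z))) / 2"
      unfolding inner_diff_left inner_scaleR_left that by (simp add: field_simps)
    then show ?thesis by auto
  qed
  have rt: "dist x z = sqrt (3 * s / Q) * d" if "(dist x z)\<^sup>2 = 3 * s / Q * d\<^sup>2" "d > 0" for z d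
    using that by (metis real_sqrt_mult real_sqrt_unique zero_le_dist less_imp_le)
  show ?thesis unfolding Let_def s_def[symmetric]
  proof
    assume "\<exists>k>0. dist x u = k * a \<and> dist x v = k * b \<and> dist x w = k * c"
    then obtain k where k: "dist x u = k * a" "dist x v = k * b" "dist x w = k * c" by blast
    have e: "s - 2 * (x \<bullet> u) = k\<^sup>2 * a\<^sup>2" "s - 2 * (x \<bullet> v) = k\<^sup>2 * b\<^sup>2" "s - 2 * (x \<bullet> w) = k\<^sup>2 * c\<^sup>2"
      using sq[of u] sq[of v] sq[of w] r k by (simp_all add: power_mult_distrib)
    have "3 * s = k\<^sup>2 * Q"
      using e sum by (simp add: Q_def algebra_simps)
    then have "k\<^sup>2 = 3 * s / Q" using Q by simp
    then show "(x - s *\<^sub>R m) \<bullet> u = 0 \<and> (x - s *\<^sub>R m) \<bullet> v = 0"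
      using e lin[OF m(1)] lin[OF m(2)] by simp
  next
    assume y: "(x - s *\<^sub>R m) \<bullet> u = 0 \<and> (x - s *\<^sub>R m) \<bullet> v = 0"
    \<comment> \<open>Here \<open>w = - u - v\<close>, which is why the statement tests only
      \<open>u\<close> and \<open>v\<close>.\<close>
    then have "(x - s *\<^sub>R m) \<bullet> w = 0"
      using zero by (metis add.right_neutral add_cancel_right_left inner_add_right inner_zero_right)
    then show "\<exists>k>0. dist x u = k * a \<and> dist x v = k * b \<and> dist x w = k * c"
      using y lin[OF m(1)] lin[OF m(2)] lin[OF m(3)] sq[of u] sq[of v] sq[of w] r pos s Q rt
      by (intro exI[of _ "sqrt (3 * s / Q)"]) auto
  qed
qed

text \<open>A cross term contributes \<open>2 * a * b * (- R\<^sup>2 / 2)\<close>. With squared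
  sides as weights, the last factor is positive unless the sides agree, and Heron's inequality
  bounds it from above.\<close>

lemma norm_weighted_sum:
  fixes u v w :: "real^3" and a b c R :: real
  assumes r: "u \<bullet> u = R\<^sup>2" "v \<bullet> v = R\<^sup>2" "w \<bullet> w = R\<^sup>2"
    and g: "u \<bullet> v = - R\<^sup>2 / 2" "v \<bullet> w = - R\<^sup>2 / 2" "w \<bullet> u = - R\<^sup>2 / 2"
  shows "(norm (a *\<^sub>R u + b *\<^sub>R v + c *\<^sub>R w))\<^sup>2 = R\<^sup>2 * (a\<^sup>2 + b\<^sup>2 + c\<^sup>2 - a * b - b * c - c * a)"
proof -
  have "v \<bullet> u = - R\<^sup>2 / 2" "w \<bullet> v = - R\<^sup>2 / 2" "u \<bullet> w = - R\<^sup>2 / 2"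
    using g by (simp_all add: inner_commute)
  then show ?thesis
    unfolding power2_norm_eq_inner
    by (simp add: inner_add_left inner_add_right r g algebra_simps power2_eq_square)
qed

section \<open>The circle orthogonal to the plane\<close>

text \<open>Normal form of the theorem: \<open>f\<close> and \<open>e\<close> span the directions of
  \<open>Pi\<close>, and the circle lies in the plane through \<open>M0\<close> normal to
  \<open>e\<close>. Completing the square gives centre \<open>M0 + c *\<^sub>R f\<close> and squared
  radius \<open>c\<^sup>2 - R\<^sup>2\<close>, positive as \<open>0 < R < c\<close>.\<close>

lemma orthogonal_circle_properties:
  fixes e f n M0 :: "real^3" and S Pi :: "(real^3) set"
  assumes on: "e \<bullet> e = 1" "f \<bullet> f = 1" "n \<bullet> n = 1" "f \<bullet> e = 0" "f \<bullet> n = 0" "e \<bullet> n = 0"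
    and c: "0 < R" "R < c"
    and S: "\<And>x. M0 + x \<in> S \<longleftrightarrow> x \<bullet> x + R\<^sup>2 = 2 * c * (x \<bullet> f) \<and> x \<bullet> e = 0"
    and Pi: "\<And>x. M0 + x \<in> Pi \<longleftrightarrow> x \<bullet> n = 0"
  shows "(\<exists>!P. P \<in> Pi \<and> dist M0 P < R \<and> P \<in> S) \<and>
    (\<exists>!P'. P' \<in> Pi \<and> dist M0 P' > R \<and> P' \<in> S) \<and>
    (\<forall>P P'. P \<in> Pi \<and> dist M0 P < R \<and> P \<in> S \<longrightarrow>
            P' \<in> Pi \<and> dist M0 P' > R \<and> P' \<in> S \<longrightarrow>
       (\<exists>E M r. is_circle S E M r \<and> is_diameter P P' S M \<and>
          circle_meets_orthogonally S E M Pi \<and>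
          (\<exists>W W'. W \<noteq> W' \<and> Pi \<inter> sphere M0 R \<inter> E = {W, W'} \<and> is_Apollonius_circle S E W W')))"
proof -
  note ip = orthonormal_inner[OF on]
  define r where "r = sqrt (c\<^sup>2 - R\<^sup>2)"
  have "c\<^sup>2 - R\<^sup>2 > 0" using c by (simp add: power_strict_mono)
  then have r: "r > 0" "r\<^sup>2 = c\<^sup>2 - R\<^sup>2" by (simp_all add: r_def)
  \<comment> \<open>The points at \<open>c - r\<close> and \<open>c + r\<close> along
    \<open>f\<close> are inverse in the circle of radius \<open>R\<close> about \<open>M0\<close>,
    so one lies inside it and the other outside.\<close>
  have prod: "(c - r) * (c + r) = R * R" using r by (simp add: algebra_simps power2_eq_square)
  have "r < c" using r c by (intro power2_less_imp_less[of r c]) auto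
  have lt: "c - r < R" "R < c + r"
  proof -
    show "R < c + r" using c r by simp
    then have "R * (c - r) < (c + r) * (c - r)" using \<open>r < c\<close> by simp
    then show "c - r < R" using prod c by (simp add: mult.commute)
  qed
  define M where "M = M0 + c *\<^sub>R f"
  define E where "E = {X. (X - M0) \<bullet> e = 0}"
  define P1 where "P1 = M0 + (c - r) *\<^sub>R f"
  define P2 where "P2 = M0 + (c + r) *\<^sub>R f"
  have S': "X \<in> S \<longleftrightarrow> (X - M0) \<bullet> (X - M0) + R\<^sup>2 = 2 * c * ((X - M0) \<bullet> f) \<and> X \<in> E" for X
    using S[of "X - M0"] by (simp add: E_def)
  have Pi': "X \<in> Pi \<longleftrightarrow> (X - M0) \<bullet> n = 0" for X
    using Pi[of "X - M0"] by simp
  \<comment> \<open>\<open>Pi\<close> and \<open>E\<close> meet in the line through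
    \<open>M0\<close> along \<open>f\<close>, since the \<open>e\<close> and \<open>n\<close>
    coordinates vanish there.\<close>
  have on_f: "X = M0 + ((X - M0) \<bullet> f) *\<^sub>R f" if "X \<in> Pi" "X \<in> E" for X
  proof -
    define z where "z = X - M0 - ((X - M0) \<bullet> f) *\<^sub>R f"
    have "z \<bullet> f = 0" "z \<bullet> e = 0" "z \<bullet> n = 0"
      using that on by (simp_all add: z_def Pi' E_def inner_diff_left)
    then have "z = 0" using ip[of z z] by simp
    then show ?thesis by (simp add: z_def algebra_simps)
  qed
  have f_on: "M0 + t *\<^sub>R f \<in> Pi" "M0 + t *\<^sub>R f \<in> E" for t
    using on by (simp_all add: Pi E_def)
  have "M0 + t *\<^sub>R f \<in> S \<longleftrightarrow> t = c - r \<or> t = c + r" for t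
  proof -
    have "M0 + t *\<^sub>R f \<in> S \<longleftrightarrow> (t - (c - r)) * (t - (c + r)) = 0"
      using on r by (simp add: S algebra_simps power2_eq_square) linarith
    then show ?thesis by simp
  qed
  then have SPi: "X \<in> Pi \<and> X \<in> S \<longleftrightarrow> X = P1 \<or> X = P2" for X
    using on_f f_on unfolding P1_def P2_def S' by metis
  have nf: "norm f = 1" using on by (simp add: norm_eq_1)
  have d: "dist M0 P1 < R" "R < dist M0 P2"
    using lt r \<open>r < c\<close> nf by (simp_all add: P1_def P2_def dist_norm)
  have plane: "is_plane E"
    unfolding is_plane_iff E_def using on(1)
    by (intro exI[of _ e] exI[of _ "e \<bullet> M0"]) (auto simp: inner_diff_left inner_diff_right inner_commute)
  have nsq: "(norm (x + t *\<^sub>R f))\<^sup>2 = x \<bullet> x + t\<^sup>2 + 2 * t * (x \<bullet> f)" for x t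
    unfolding power2_norm_eq_inner
    using on(2) by (simp add: inner_add_left inner_add_right inner_commute[of f x] power2_eq_square
      distrib_left)
  have sphere: "X \<in> sphere M r \<longleftrightarrow> (X - M0) \<bullet> (X - M0) + R\<^sup>2 = 2 * c * ((X - M0) \<bullet> f)" for X
  proof -
    have M: "X - M = X - M0 + (- c) *\<^sub>R f" by (simp add: M_def)
    have "(dist X M)\<^sup>2 = (X - M0) \<bullet> (X - M0) - 2 * c * ((X - M0) \<bullet> f) + c\<^sup>2"
      unfolding dist_norm M nsq by simp
    moreover have "X \<in> sphere M r \<longleftrightarrow> (dist X M)\<^sup>2 = r\<^sup>2"
      using r(1) by (simp add: dist_commute power2_eq_iff_nonneg)
    ultimately show ?thesis using r(2) by auto
  qed
  have circle: "is_circle S E M r"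
    unfolding is_circle_def using plane r(1) f_on M_def sphere S' by blast
  have "P1 \<in> S" "P2 \<in> S" using SPi by auto
  then have diam: "is_diameter P1 P2 S M"
    unfolding is_diameter_def eq_commute[of M] midpoint_eq_iff
    by (simp add: P1_def P2_def M_def algebra_simps)
  have perp: "perpendicular (tangent_line E M X) Pi" if "X = P1 \<or> X = P2" for X
  proof -
    \<comment> \<open>The radius at either point is a nonzero multiple of \<open>f\<close>. Tangent
      directions thus have no \<open>f\<close> or \<open>e\<close> coordinate, while directions of
      \<open>Pi\<close> have no \<open>n\<close> coordinate.\<close>
    obtain q where q: "q \<noteq> 0" "X - M = q *\<^sub>R f"
    proof (cases "X = P1")
      case True
      then show thesis using r(1) by (intro that[of "- r"]) (simp_all add: P1_def M_def algebra_simps)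
    next
      case False
      then have "X = P2" using \<open>X = P1 \<or> X = P2\<close> by simp
      then show thesis using r(1) by (intro that[of r]) (simp_all add: P2_def M_def algebra_simps)
    qed
    have T: "(Y - Z) \<bullet> f = 0 \<and> (Y - Z) \<bullet> e = 0"
      if "Y \<in> tangent_line E M X" "Z \<in> tangent_line E M X" for Y Z
      using that q by (auto simp: tangent_line_def q orthogonal_def E_def inner_diff_left)
    have "(U - V) \<bullet> n = 0" if "U \<in> Pi" "V \<in> Pi" for U V
      using that by (simp add: Pi' inner_diff_left)
    then have "(Y - Z) \<bullet> (U - V) = 0"
      if "Y \<in> tangent_line E M X" "Z \<in> tangent_line E M X" "U \<in> Pi" "V \<in> Pi" for Y Z U V
      using T[OF that(1,2)] that(3,4) by (subst ip) simp
    then show ?thesis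
      unfolding perpendicular_def orthogonal_def by blast
  qed
  have orth: "circle_meets_orthogonally S E M Pi"
    unfolding circle_meets_orthogonally_def using perp SPi by blast
  define W where "W = M0 + R *\<^sub>R f"
  define W' where "W' = M0 - R *\<^sub>R f"
  have foci: "W \<noteq> W'" "Pi \<inter> sphere M0 R \<inter> E = {W, W'}"
  proof -
    have "f \<noteq> 0" using nf by auto
    then show "W \<noteq> W'"
      using c(1) by (auto simp: W_def W'_def eq_neg_iff_add_eq_0 simp flip: scaleR_add_left)
    have W': "W' = M0 + (- R) *\<^sub>R f" by (simp add: W'_def)
    have "X = W \<or> X = W'" if "X \<in> Pi" "X \<in> sphere M0 R" "X \<in> E" for X
    proof -
      define t where "t = (X - M0) \<bullet> f"
      have "X = M0 + t *\<^sub>R f" using on_f[OF that(1,3)] by (simp only: t_def)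
      with that(2) nf show ?thesis by (auto simp: W_def W' dist_norm)
    qed
    moreover have "W \<in> sphere M0 R" "W' \<in> sphere M0 R"
      using nf c by (auto simp: W_def W' dist_norm)
    ultimately show "Pi \<inter> sphere M0 R \<inter> E = {W, W'}"
      using f_on[of R] f_on[of "- R"] W_def W' by blast
  qed
  have apo: "is_Apollonius_circle S E W W'"
  proof -
    \<comment> \<open>With \<open>x = X - M0\<close> and the equation of the circle, the squared
      distances to the foci are \<open>2 * (c - R) * (x \<bullet> f)\<close> and
      \<open>2 * (c + R) * (x \<bullet> f)\<close>.\<close>
    define k where "k = sqrt ((c - R) / (c + R))"
    have k: "k > 0" "k\<^sup>2 = (c - R) / (c + R)" using c by (simp_all add: k_def)
    have "X \<in> S \<longleftrightarrow> dist X W / dist X W' = k" if "X \<in> E" for X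
    proof -
      define x where "x = X - M0"
      have WW: "X - W = x + (- R) *\<^sub>R f" "X - W' = x + R *\<^sub>R f"
        by (simp_all add: W_def W'_def x_def)
      have W: "(dist X W)\<^sup>2 = x \<bullet> x + R\<^sup>2 - 2 * R * (x \<bullet> f)"
        and W': "(dist X W')\<^sup>2 = x \<bullet> x + R\<^sup>2 + 2 * R * (x \<bullet> f)"
        unfolding dist_norm WW nsq by simp_all
      have "dist X W / dist X W' = k \<longleftrightarrow> dist X W = k * dist X W'"
      proof (cases "dist X W' = 0")
        \<comment> \<open>At \<open>W'\<close> the quotient is \<open>0\<close> by convention, and
          the product equation would force \<open>W = W'\<close>.\<close>
        case True
        then show ?thesis using k(1) foci(1) by auto
      qed (simp add: field_simps)
      also have "\<dots> \<longleftrightarrow> (dist X W)\<^sup>2 = (k * dist X W')\<^sup>2"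
        using k(1) by (simp add: power2_eq_iff_nonneg)
      also have "\<dots> \<longleftrightarrow> (c + R) * (dist X W)\<^sup>2 = (c - R) * (dist X W')\<^sup>2"
        using c by (simp add: power_mult_distrib k(2) field_simps)
      also have "\<dots> \<longleftrightarrow> 2 * R * (x \<bullet> x + R\<^sup>2 - 2 * c * (x \<bullet> f)) = 0"
        unfolding W W' by (simp add: algebra_simps)
      also have "\<dots> \<longleftrightarrow> X \<in> S"
        using c(1) that by (simp add: S' x_def)
      finally show ?thesis by simp
    qed
    then show ?thesis
      unfolding is_Apollonius_circle_def using k(1) foci S' by blast
  qed
  have u1: "P = P1" if "P \<in> Pi" "dist M0 P < R" "P \<in> S" for P using that SPi d by force
  have u2: "P = P2" if "P \<in> Pi" "R < dist M0 P" "P \<in> S" for P using that SPi d by force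
  show ?thesis
  proof (intro conjI allI impI)
    show "\<exists>!P. P \<in> Pi \<and> dist M0 P < R \<and> P \<in> S"
      using u1 SPi[of P1] d(1) by (intro ex1I[of _ P1]) auto
    show "\<exists>!P'. P' \<in> Pi \<and> dist M0 P' > R \<and> P' \<in> S"
      using u2 SPi[of P2] d(2) by (intro ex1I[of _ P2]) auto
  next
    fix P P'
    assume "P \<in> Pi \<and> dist M0 P < R \<and> P \<in> S" "P' \<in> Pi \<and> dist M0 P' > R \<and> P' \<in> S"
    then have "P = P1" "P' = P2" using u1 u2 by auto
    then show "\<exists>E M r. is_circle S E M r \<and> is_diameter P P' S M \<and>
        circle_meets_orthogonally S E M Pi \<and>
        (\<exists>W W'. W \<noteq> W' \<and> Pi \<inter> sphere M0 R \<inter> E = {W, W'} \<and> is_Apollonius_circle S E W W')"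
      using circle diam orth foci apo by blast
  qed
qed

section \<open>Reduction of the locus to the normal form\<close>

theorem corollary5:
  fixes Pi \<Gamma>0 :: "(real^3) set" and A0 B0 C0 M0 :: "real^3" and R :: real
    and A B C :: complex
  defines "S \<equiv> similarity_locus A0 B0 C0 A B C"
  assumes "is_plane Pi"
    and "equilateral A0 B0 C0" and "{A0, B0, C0} \<subseteq> Pi"
    and "is_circle \<Gamma>0 Pi M0 R" and "{A0, B0, C0} \<subseteq> \<Gamma>0"
    and "anticlockwise A B C" and "\<not> equilateral A B C"
  shows "(\<exists>!P. P \<in> Pi \<and> dist M0 P < R \<and> P \<in> S) \<and>
    (\<exists>!P'. P' \<in> Pi \<and> dist M0 P' > R \<and> P' \<in> S) \<and>
    (\<forall>P P'. P \<in> Pi \<and> dist M0 P < R \<and> P \<in> S \<longrightarrow>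
            P' \<in> Pi \<and> dist M0 P' > R \<and> P' \<in> S \<longrightarrow>
       (\<exists>E M r. is_circle S E M r \<and> is_diameter P P' S M \<and>
          circle_meets_orthogonally S E M Pi \<and>
          (\<exists>W W'. W \<noteq> W' \<and> \<Gamma>0 \<inter> E = {W, W'} \<and> is_Apollonius_circle S E W W')))"
proof -
  obtain n \<beta> where n: "n \<bullet> n = 1" "Pi = {X. n \<bullet> X = \<beta>}"
    using \<open>is_plane Pi\<close> is_plane_iff by blast
  have G: "\<Gamma>0 = Pi \<inter> sphere M0 R" "M0 \<in> Pi" "R > 0"
    using \<open>is_circle \<Gamma>0 Pi M0 R\<close> by (auto simp: is_circle_def)
  define u v w where uvw: "u = A0 - M0" "v = B0 - M0" "w = C0 - M0"
  have Pi: "M0 + x \<in> Pi \<longleftrightarrow> x \<bullet> n = 0" for x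
    using G(2) by (auto simp: n inner_add_right inner_commute)
  have nu: "u \<bullet> n = 0" "v \<bullet> n = 0" "w \<bullet> n = 0"
    using assms(4) Pi[of u] Pi[of v] Pi[of w] by (auto simp: uvw)
  have r: "u \<bullet> u = R\<^sup>2" "v \<bullet> v = R\<^sup>2" "w \<bullet> w = R\<^sup>2"
    using assms(6) by (auto simp: G uvw dist_norm norm_minus_commute simp flip: power2_norm_eq_inner)
  have "dist u v = dist v w" "dist v w = dist w u" "u \<noteq> v"
    using \<open>equilateral A0 B0 C0\<close> by (auto simp: equilateral_def uvw dist_norm)
  note g = equilateral_inner[OF n(1) nu r this]
  define a b c where abc: "a = dist B C" "b = dist C A" "c = dist A B"
  have pos: "a > 0" "b > 0" "c > 0"
    using anticlockwise_distinct[OF assms(7)] by (auto simp: abc)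
  define Q where "Q = a\<^sup>2 + b\<^sup>2 + c\<^sup>2"
  have Q: "Q > 0" using pos by (simp add: Q_def add_pos_pos)
  \<comment> \<open>This is the vector written \<open>v\<close> in the overview; here
    \<open>v\<close> points to \<open>B0\<close>.\<close>
  define m where "m = (- 1 / (R\<^sup>2 * Q)) *\<^sub>R (a\<^sup>2 *\<^sub>R u + b\<^sup>2 *\<^sub>R v + c\<^sup>2 *\<^sub>R w)"
  define N where "N = (a\<^sup>2)\<^sup>2 + (b\<^sup>2)\<^sup>2 + (c\<^sup>2)\<^sup>2 - a\<^sup>2 * b\<^sup>2 - b\<^sup>2 * c\<^sup>2 - c\<^sup>2 * a\<^sup>2"
  have norm_m: "(norm m)\<^sup>2 = N / (R\<^sup>2 * Q\<^sup>2)"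
    unfolding m_def norm_scaleR power_mult_distrib norm_weighted_sum[OF r g] N_def[symmetric]
    using G(3) Q by (simp add: field_simps power2_eq_square)
  have "2 * N = (a\<^sup>2 - b\<^sup>2)\<^sup>2 + (b\<^sup>2 - c\<^sup>2)\<^sup>2 + (c\<^sup>2 - a\<^sup>2)\<^sup>2"
    unfolding N_def by algebra
  moreover have "a\<^sup>2 \<noteq> b\<^sup>2 \<or> b\<^sup>2 \<noteq> c\<^sup>2"
    using assms(8) pos by (auto simp: equilateral_def abc power2_eq_iff_nonneg)
  ultimately have "N > 0"
    by (smt (verit) zero_less_power2 zero_le_power2)
  then have m0: "m \<noteq> 0"
    using norm_m G(3) Q by auto
  \<comment> \<open>\<open>Q\<^sup>2 - 4 * N\<close> is three times the difference of the two sides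
    in \<open>heron_pos\<close>.\<close>
  have "4 * N < Q\<^sup>2"
    using heron_pos[OF assms(7)] unfolding N_def Q_def abc[symmetric]
    by (simp add: power2_eq_square algebra_simps)
  then have "(2 * R * norm m)\<^sup>2 < 1\<^sup>2"
    using G(3) Q by (simp add: power_mult_distrib norm_m)
  then have m1: "2 * R * norm m < 1"
    by (rule power2_less_imp_less) simp
  define f where "f = m /\<^sub>R norm m"
  have f: "f \<bullet> f = 1" "f \<bullet> n = 0"
    using m0 nu by (auto simp: f_def dot_square_norm power2_eq_square m_def inner_add_left)
  obtain e where e: "e \<bullet> e = 1" "f \<bullet> e = 0" "e \<bullet> n = 0"
    using orthonormal_completion[OF f(1) n(1) f(2)] by blast
  have ip: "y \<bullet> z = (y \<bullet> f) * (z \<bullet> f) + (y \<bullet> e) * (z \<bullet> e)" if "z \<bullet> n = 0" for y z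
    using orthonormal_inner[OF e(1) f(1) n(1) e(2) f(2) e(3), of y z] that by simp
  \<comment> \<open>The distance from \<open>M0\<close> to the centre of the circle;
    \<open>R < \<kappa>\<close> restates \<open>2 * R * norm m < 1\<close>.\<close>
  define \<kappa> where "\<kappa> = 1 / (2 * norm m)"
  have \<kappa>: "R < \<kappa>" using m0 m1 by (simp add: \<kappa>_def field_simps)
  have mf: "m = norm m *\<^sub>R f" using m0 by (simp add: f_def)
  have span: "y \<bullet> u = 0 \<and> y \<bullet> v = 0 \<longleftrightarrow> y \<bullet> f = 0 \<and> y \<bullet> e = 0" for y
  proof
    assume y: "y \<bullet> u = 0 \<and> y \<bullet> v = 0"
    \<comment> \<open>Cramer's rule: \<open>D\<close> is the determinant of \<open>u\<close>,
      \<open>v\<close> in the frame \<open>f\<close>, \<open>e\<close>, and its square is their Gram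
      determinant.\<close>
    define D where "D = (u \<bullet> f) * (v \<bullet> e) - (u \<bullet> e) * (v \<bullet> f)"
    have "D\<^sup>2 = (u \<bullet> u) * (v \<bullet> v) - (u \<bullet> v)\<^sup>2"
      unfolding ip[OF nu(1)] ip[OF nu(2)] D_def by algebra
    also have "\<dots> = 3 / 4 * R ^ 4"
      using r g by (simp add: power2_eq_square power4_eq_xxxx)
    finally have "D \<noteq> 0" using G(3) by auto
    have "(y \<bullet> f) * D = (y \<bullet> u) * (v \<bullet> e) - (y \<bullet> v) * (u \<bullet> e)"
      "(y \<bullet> e) * D = (y \<bullet> v) * (u \<bullet> f) - (y \<bullet> u) * (v \<bullet> f)"
      unfolding ip[OF nu(1), of y] ip[OF nu(2), of y] D_def by algebra+
    then show "y \<bullet> f = 0 \<and> y \<bullet> e = 0" using y \<open>D \<noteq> 0\<close> by simp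
  next
    assume "y \<bullet> f = 0 \<and> y \<bullet> e = 0"
    then show "y \<bullet> u = 0 \<and> y \<bullet> v = 0" using ip[OF nu(1), of y] ip[OF nu(2), of y] by simp
  qed
  have S: "M0 + x \<in> S \<longleftrightarrow> x \<bullet> x + R\<^sup>2 = 2 * \<kappa> * (x \<bullet> f) \<and> x \<bullet> e = 0" for x
  proof -
    have "dist (M0 + x) A0 = dist x u" "dist (M0 + x) B0 = dist x v" "dist (M0 + x) C0 = dist x w"
      by (simp_all add: uvw dist_norm algebra_simps)
    then have "M0 + x \<in> S \<longleftrightarrow> (\<exists>k>0. dist x u = k * a \<and> dist x v = k * b \<and> dist x w = k * c)"
      by (simp add: S_def similarity_locus_def sides_similar_iff[OF assms(7)] abc)
    \<comment> \<open>The tests against \<open>u\<close>, \<open>v\<close> become tests against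
      \<open>f\<close>, \<open>e\<close>, and \<open>m\<close> has only an \<open>f\<close>
      coordinate.\<close>
    also have "\<dots> \<longleftrightarrow> (let y = x - (x \<bullet> x + R\<^sup>2) *\<^sub>R m in y \<bullet> f = 0 \<and> y \<bullet> e = 0)"
      using proportional_distances_iff[OF G(3) pos r g, of x] unfolding m_def Q_def Let_def span .
    also have "\<dots> \<longleftrightarrow> x \<bullet> f = (x \<bullet> x + R\<^sup>2) * norm m \<and> x \<bullet> e = 0"
      by (subst mf) (simp add: Let_def inner_diff_left f(1) e(2))
    also have "\<dots> \<longleftrightarrow> x \<bullet> x + R\<^sup>2 = 2 * \<kappa> * (x \<bullet> f) \<and> x \<bullet> e = 0"
      using m0 by (auto simp: \<kappa>_def field_simps)
    finally show ?thesis .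
  qed
  show ?thesis
    unfolding G(1)
    using orthogonal_circle_properties[OF e(1) f(1) n(1) e(2) f(2) e(3) G(3) \<kappa> S Pi] .
qed

end
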